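(* Let $M$ be a model of a complete first-order theory $T$. If a partitioned formula $\varphi(x,y)$ is a $1$-semi-equation, then the relation $\{(a,b)\in M^x\times M^y: M\models\varphi(a,b)\}$ satisfies the strong EH property (sEH). In particular, if $T$ is $1$-semi-equational, then for every partitioned formula $\varphi(x,y)$ the relation it defines on $M^x\times M^y$ satisfies sEH.
   Context: $x,y$ are finite tuples of variables, $M^x$ is the set of tuples from $M$ of the sort of $x$, and $\varphi(M,b)=\{a\in M^x: M\models\varphi(a,b)\}$ for $b\in M^y$. A partitioned formula $\varphi(x,y)$ is a $(k,1)$-semi-equation if for any $b_1,\dots,b_k\in M^y$ with $\bigcap_{i=1}^k\varphi(M,b_i)\neq\emptyset$ we have $\varphi(M,b_i)\subseteq\varphi(M,b_j)$ for some $i\neq j$ in $\{1,\dots,k\}$. It is a $1$-semi-equation if it is a $(k,1)$-semi-equation for some $k\in\mathbb N$. A theory $T$ is $1$-semi-equational if every partitioned formula is equivalent (in $T$) to a Boolean combination of $1$-semi-equations (in the same partitioned variables). sEH: a relation $E\subseteq X\times Y$ satisfies sEH if there is a real $\beta>0$ such that for any probability measures $\mu$ on $X$ and $\nu$ on $Y$ concentrated on finite subsets there are $X_0\subseteq X$, $Y_0\subseteq Y$ with $\mu(X_0),\nu(Y_0)>\beta$ and either $X_0\times Y_0\subseteq E$ or $(X_0\times Y_0)\cap E=\emptyset$. *)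

theory Defs
  imports "HOL-Probability.Probability"
begin

section \<open>Many-sorted first-order logic with equality\<close>

text \<open>
  Every element of the type \<open>'s\<close> is a sort, and a variable carries its sort as second component.
  The symbols of a language are only those in \<open>funs\<close> and \<open>rels\<close>, either of which may be empty;
  constants are function symbols whose list of argument sorts is empty.
\<close>

record ('f, 'r, 's) language =
  funs :: "'f set"
  rels :: "'r set"
  fdom :: "'f \<Rightarrow> 's list"
  fcod :: "'f \<Rightarrow> 's"
  rdom :: "'r \<Rightarrow> 's list"

type_synonym 's var = "nat \<times> 's"

datatype ('f, 's) trm = Var "'s var" | Fn 'f "('f, 's) trm list"

datatype ('f, 'r, 's) fm =
    Eql "('f, 's) trm" "('f, 's) trm"
  | Rel 'r "('f, 's) trm list"
  | Neg "('f, 'r, 's) fm"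
  | Conj "('f, 'r, 's) fm" "('f, 'r, 's) fm"
  | Ex "'s var" "('f, 'r, 's) fm"

definition Iff :: "('f, 'r, 's) fm \<Rightarrow> ('f, 'r, 's) fm \<Rightarrow> ('f, 'r, 's) fm" where
  "Iff \<phi> \<psi> = Conj (Neg (Conj \<phi> (Neg \<psi>))) (Neg (Conj \<psi> (Neg \<phi>)))"

primrec sort_of :: "('f, 'r, 's) language \<Rightarrow> ('f, 's) trm \<Rightarrow> 's" where
  "sort_of L (Var z) = snd z"
| "sort_of L (Fn f ts) = fcod L f"

fun wf_trm :: "('f, 'r, 's) language \<Rightarrow> ('f, 's) trm \<Rightarrow> bool" where
  "wf_trm L (Var z) \<longleftrightarrow> True"
| "wf_trm L (Fn f ts) \<longleftrightarrow>
     f \<in> funs L \<and> map (sort_of L) ts = fdom L f \<and> (\<forall>t\<in>set ts. wf_trm L t)"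

fun wf_fm :: "('f, 'r, 's) language \<Rightarrow> ('f, 'r, 's) fm \<Rightarrow> bool" where
  "wf_fm L (Eql t u) \<longleftrightarrow> wf_trm L t \<and> wf_trm L u \<and> sort_of L t = sort_of L u"
| "wf_fm L (Rel r ts) \<longleftrightarrow>
     r \<in> rels L \<and> map (sort_of L) ts = rdom L r \<and> (\<forall>t\<in>set ts. wf_trm L t)"
| "wf_fm L (Neg \<phi>) \<longleftrightarrow> wf_fm L \<phi>"
| "wf_fm L (Conj \<phi> \<psi>) \<longleftrightarrow> wf_fm L \<phi> \<and> wf_fm L \<psi>"
| "wf_fm L (Ex z \<phi>) \<longleftrightarrow> wf_fm L \<phi>"

fun fv_trm :: "('f, 's) trm \<Rightarrow> 's var set" where
  "fv_trm (Var z) = {z}"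
| "fv_trm (Fn f ts) = (\<Union>t\<in>set ts. fv_trm t)"

fun fv :: "('f, 'r, 's) fm \<Rightarrow> 's var set" where
  "fv (Eql t u) = fv_trm t \<union> fv_trm u"
| "fv (Rel r ts) = (\<Union>t\<in>set ts. fv_trm t)"
| "fv (Neg \<phi>) = fv \<phi>"
| "fv (Conj \<phi> \<psi>) = fv \<phi> \<union> fv \<psi>"
| "fv (Ex z \<phi>) = fv \<phi> - {z}"

definition sentence :: "('f, 'r, 's) language \<Rightarrow> ('f, 'r, 's) fm \<Rightarrow> bool" where
  "sentence L \<sigma> \<longleftrightarrow> wf_fm L \<sigma> \<and> fv \<sigma> = {}"

record ('f, 'r, 's, 'a) interp =
  univ :: "'s \<Rightarrow> 'a set"
  fint :: "'f \<Rightarrow> 'a list \<Rightarrow> 'a"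
  rint :: "'r \<Rightarrow> 'a list \<Rightarrow> bool"

definition is_structure :: "('f, 'r, 's) language \<Rightarrow> ('f, 'r, 's, 'a) interp \<Rightarrow> bool" where
  "is_structure L M \<longleftrightarrow>
     (\<forall>s. univ M s \<noteq> {}) \<and>
     (\<forall>f\<in>funs L. \<forall>as. list_all2 (\<lambda>a s. a \<in> univ M s) as (fdom L f) \<longrightarrow>
        fint M f as \<in> univ M (fcod L f))"

definition valuation :: "('f, 'r, 's, 'a) interp \<Rightarrow> ('s var \<Rightarrow> 'a) \<Rightarrow> bool" where
  "valuation M v \<longleftrightarrow> (\<forall>z. v z \<in> univ M (snd z))"

fun eval_trm :: "('f, 'r, 's, 'a) interp \<Rightarrow> ('s var \<Rightarrow> 'a) \<Rightarrow> ('f, 's) trm \<Rightarrow> 'a" where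
  "eval_trm M v (Var z) = v z"
| "eval_trm M v (Fn f ts) = fint M f (map (eval_trm M v) ts)"

fun sat :: "('f, 'r, 's, 'a) interp \<Rightarrow> ('s var \<Rightarrow> 'a) \<Rightarrow> ('f, 'r, 's) fm \<Rightarrow> bool" where
  "sat M v (Eql t u) \<longleftrightarrow> eval_trm M v t = eval_trm M v u"
| "sat M v (Rel r ts) \<longleftrightarrow> rint M r (map (eval_trm M v) ts)"
| "sat M v (Neg \<phi>) \<longleftrightarrow> \<not> sat M v \<phi>"
| "sat M v (Conj \<phi> \<psi>) \<longleftrightarrow> sat M v \<phi> \<and> sat M v \<psi>"
| "sat M v (Ex z \<phi>) \<longleftrightarrow> (\<exists>a\<in>univ M (snd z). sat M (v(z := a)) \<phi>)"

definition valid_in :: "('f, 'r, 's, 'a) interp \<Rightarrow> ('f, 'r, 's) fm \<Rightarrow> bool" where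
  "valid_in M \<phi> \<longleftrightarrow> (\<forall>v. valuation M v \<longrightarrow> sat M v \<phi>)"

definition is_model ::
  "('f, 'r, 's) language \<Rightarrow> ('f, 'r, 's, 'a) interp \<Rightarrow> ('f, 'r, 's) fm set \<Rightarrow> bool" where
  "is_model L M T \<longleftrightarrow> is_structure L M \<and> (\<forall>\<sigma>\<in>T. valid_in M \<sigma>)"

text \<open>
  HOL cannot quantify over all models of all types at once. By the downward Loewenheim-Skolem
  theorem it is enough to consider models whose elements come from one infinite type at least as
  large as the language. The type of formulas is such a type, whence the type of \<open>N\<close> in the next two
  definitions; they agree with the usual notions, in which models have arbitrary universes.
\<close>

definition entails ::
  "('f, 'r, 's) language \<Rightarrow> ('f, 'r, 's) fm set \<Rightarrow> ('f, 'r, 's) fm \<Rightarrow> bool" where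
  "entails L T \<phi> \<longleftrightarrow>
     (\<forall>N :: ('f, 'r, 's, ('f, 'r, 's) fm) interp. is_model L N T \<longrightarrow> valid_in N \<phi>)"

definition complete_theory :: "('f, 'r, 's) language \<Rightarrow> ('f, 'r, 's) fm set \<Rightarrow> bool" where
  "complete_theory L T \<longleftrightarrow>
     (\<forall>\<sigma>\<in>T. sentence L \<sigma>) \<and>
     (\<exists>N :: ('f, 'r, 's, ('f, 'r, 's) fm) interp. is_model L N T) \<and>
     (\<forall>\<sigma>. sentence L \<sigma> \<longrightarrow> entails L T \<sigma> \<or> entails L T (Neg \<sigma>))"

definition equivalent_in ::
  "('f, 'r, 's) language \<Rightarrow> ('f, 'r, 's) fm set \<Rightarrow> ('f, 'r, 's) fm \<Rightarrow> ('f, 'r, 's) fm \<Rightarrow> bool" where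
  "equivalent_in L T \<phi> \<psi> \<longleftrightarrow> entails L T (Iff \<phi> \<psi>)"


section \<open>Partitioned formulas and semi-equations\<close>

definition partitioned ::
  "('f, 'r, 's) language \<Rightarrow> 's var list \<Rightarrow> 's var list \<Rightarrow> ('f, 'r, 's) fm \<Rightarrow> bool" where
  "partitioned L x y \<phi> \<longleftrightarrow> wf_fm L \<phi> \<and> distinct (x @ y) \<and> fv \<phi> \<subseteq> set x \<union> set y"

definition tuples :: "('f, 'r, 's, 'a) interp \<Rightarrow> 's var list \<Rightarrow> 'a list set" where
  "tuples M x = {a. list_all2 (\<lambda>c z. c \<in> univ M (snd z)) a x}"

text \<open>
  Variables outside \<open>x\<close> and \<open>y\<close> receive an unspecified value, which is irrelevant for
  \<open>partitioned\<close> formulas.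
\<close>

definition holds_at ::
  "('f, 'r, 's, 'a) interp \<Rightarrow> 's var list \<Rightarrow> 's var list \<Rightarrow> ('f, 'r, 's) fm \<Rightarrow>
   'a list \<Rightarrow> 'a list \<Rightarrow> bool" where
  "holds_at M x y \<phi> a b \<longleftrightarrow> sat M (\<lambda>z. the (map_of (zip (x @ y) (a @ b)) z)) \<phi>"

definition instance_set ::
  "('f, 'r, 's, 'a) interp \<Rightarrow> 's var list \<Rightarrow> 's var list \<Rightarrow> ('f, 'r, 's) fm \<Rightarrow>
   'a list \<Rightarrow> 'a list set" where
  "instance_set M x y \<phi> b = {a \<in> tuples M x. holds_at M x y \<phi> a b}"

definition defined_relation ::
  "('f, 'r, 's, 'a) interp \<Rightarrow> 's var list \<Rightarrow> 's var list \<Rightarrow> ('f, 'r, 's) fm \<Rightarrow>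
   ('a list \<times> 'a list) set" where
  "defined_relation M x y \<phi> = {(a, b) \<in> tuples M x \<times> tuples M y. holds_at M x y \<phi> a b}"

definition k1_semi_equation ::
  "nat \<Rightarrow> ('f, 'r, 's) language \<Rightarrow> ('f, 'r, 's, 'a) interp \<Rightarrow> 's var list \<Rightarrow> 's var list \<Rightarrow>
   ('f, 'r, 's) fm \<Rightarrow> bool" where
  "k1_semi_equation k L M x y \<phi> \<longleftrightarrow>
     partitioned L x y \<phi> \<and>
     (\<forall>b :: nat \<Rightarrow> 'a list.
        (\<forall>i\<in>{1..k}. b i \<in> tuples M y) \<and> (\<Inter>i\<in>{1..k}. instance_set M x y \<phi> (b i)) \<noteq> {} \<longrightarrow>
        (\<exists>i\<in>{1..k}. \<exists>j\<in>{1..k}. i \<noteq> j \<and>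
           instance_set M x y \<phi> (b i) \<subseteq> instance_set M x y \<phi> (b j)))"

definition one_semi_equation ::
  "('f, 'r, 's) language \<Rightarrow> ('f, 'r, 's, 'a) interp \<Rightarrow> 's var list \<Rightarrow> 's var list \<Rightarrow>
   ('f, 'r, 's) fm \<Rightarrow> bool" where
  "one_semi_equation L M x y \<phi> \<longleftrightarrow> (\<exists>k. k1_semi_equation k L M x y \<phi>)"

inductive bool_comb :: "(('f, 'r, 's) fm \<Rightarrow> bool) \<Rightarrow> ('f, 'r, 's) fm \<Rightarrow> bool"
  for P where
  base: "P \<phi> \<Longrightarrow> bool_comb P \<phi>"
| neg: "bool_comb P \<phi> \<Longrightarrow> bool_comb P (Neg \<phi>)"
| conj: "bool_comb P \<phi> \<Longrightarrow> bool_comb P \<psi> \<Longrightarrow> bool_comb P (Conj \<phi> \<psi>)"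

text \<open>
  Being a \<open>(k, 1)\<close>-semi-equation is a first-order condition on the model, so for complete \<open>T\<close>
  the following does not depend on the choice of the model \<open>M\<close> of \<open>T\<close>.
\<close>

definition one_semi_equational ::
  "('f, 'r, 's) language \<Rightarrow> ('f, 'r, 's, 'a) interp \<Rightarrow> ('f, 'r, 's) fm set \<Rightarrow> bool" where
  "one_semi_equational L M T \<longleftrightarrow>
     (\<forall>x y \<phi>. partitioned L x y \<phi> \<longrightarrow>
        (\<exists>\<psi>. bool_comb (one_semi_equation L M x y) \<psi> \<and> equivalent_in L T \<phi> \<psi>))"


section \<open>The strong EH property\<close>

text \<open>Probability measures concentrated on finite subsets are finitely supported mass functions.\<close>

definition sEH :: "'a set \<Rightarrow> 'b set \<Rightarrow> ('a \<times> 'b) set \<Rightarrow> bool" where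
  "sEH X Y E \<longleftrightarrow>
     (\<exists>\<beta>::real. \<beta> > 0 \<and>
        (\<forall>(\<mu> :: 'a pmf) (\<nu> :: 'b pmf).
           finite (set_pmf \<mu>) \<and> set_pmf \<mu> \<subseteq> X \<and> finite (set_pmf \<nu>) \<and> set_pmf \<nu> \<subseteq> Y \<longrightarrow>
           (\<exists>X0 Y0. X0 \<subseteq> X \<and> Y0 \<subseteq> Y \<and>
              measure_pmf.prob \<mu> X0 > \<beta> \<and> measure_pmf.prob \<nu> Y0 > \<beta> \<and>
              (X0 \<times> Y0 \<subseteq> E \<or> (X0 \<times> Y0) \<inter> E = {}))))"

end

(*
  Two ideas. For a semi-equation the fibres through a point contain no antichain of k sets. If half of
  the fibres have measure at most 1/2, a random union of maximal ones leaves an empty box; otherwise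
  some point lies in a quarter of the large fibres, and a minimal one among these, together with the
  parameters of the fibres containing it, gives a full box.

  Boolean combinations are dealt with by restricting the measures to a homogeneous box and repeating.
  Entailment only speaks of models living on the type of formulas, so an equivalence modulo T is
  transferred to M through a countermodel in M, whose Skolem hull is coded by formulas.
*)
theory Submission
  imports Defs
begin

section \<open>Set systems without large antichains through a point\<close>

definition antichain :: "'a set set \<Rightarrow> bool" where
  "antichain \<A> \<longleftrightarrow> (\<forall>A\<in>\<A>. \<forall>B\<in>\<A>. A \<subseteq> B \<longrightarrow> A = B)"

text \<open>\<open>c\<close> is forced in and the elements of \<open>D\<close> are forced out, so
  \<open>Suc (card D)\<close> elements of \<open>C\<close> are decided and the others are
  free.\<close>

lemma card_subsets_containing_avoiding:
  assumes "finite C" "D \<subseteq> C" "c \<in> C - D"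
  shows "card {S \<in> Pow C. c \<in> S \<and> S \<inter> D = {}} = 2 ^ (card C - Suc (card D))"
proof -
  let ?R = "C - insert c D"
  have "{S \<in> Pow C. c \<in> S \<and> S \<inter> D = {}} = insert c ` Pow ?R"
  proof (intro equalityI subsetI)
    fix S assume "S \<in> {S \<in> Pow C. c \<in> S \<and> S \<inter> D = {}}"
    then have "S = insert c (S - {c})" "S - {c} \<in> Pow ?R" by auto
    then show "S \<in> insert c ` Pow ?R" by (rule image_eqI)
  qed (use assms in auto)
  moreover have "inj_on (insert c) (Pow ?R)"
  proof (rule inj_onI)
    fix S S' assume "S \<in> Pow ?R" "S' \<in> Pow ?R" "insert c S = insert c S'"
    then show "S = S'" by (metis DiffE Pow_iff insert_ident insertI1 subsetD)
  qed
  moreover have "card ?R = card C - Suc (card D)"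
    using assms by (subst card_Diff_subset) (auto simp: finite_subset)
  ultimately show ?thesis
    using assms by (simp add: card_image card_Pow)
qed

lemma prob_eq_sum:
  assumes "finite (set_pmf p)"
  shows "measure_pmf.prob p A = (\<Sum>x\<in>set_pmf p. pmf p x * of_bool (x \<in> A))"
proof -
  have "measure_pmf.prob p A = measure_pmf.prob p (A \<inter> set_pmf p)"
    by (simp add: measure_Int_set_pmf)
  also have "\<dots> = (\<Sum>x\<in>A \<inter> set_pmf p. pmf p x)"
    using assms by (simp add: measure_measure_pmf_finite)
  also have "\<dots> = (\<Sum>x\<in>set_pmf p. pmf p x * of_bool (x \<in> A))"
    using assms by (intro sum.mono_neutral_cong_left) auto
  finally show ?thesis .
qed

text \<open>The weights allow one averaging principle for two purposes: constant weight 1 chooses a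
  set from a finite family, and the weight \<open>pmf \<mu>\<close> chooses a point.\<close>

lemma exists_ge_average:
  fixes f w :: "'a \<Rightarrow> real"
  assumes "finite S" "\<And>x. x \<in> S \<Longrightarrow> 0 \<le> w x" "0 < sum w S" "c * sum w S \<le> (\<Sum>x\<in>S. w x * f x)"
  shows "\<exists>x\<in>S. c \<le> f x"
proof (rule ccontr)
  assume "\<not> ?thesis"
  then have less: "f x < c" if "x \<in> S" for x using that by auto
  obtain y where "y \<in> S" "w y > 0"
    using assms(1,3) by (meson linorder_not_less sum_nonpos)
  have "(\<Sum>x\<in>S. w x * f x) < (\<Sum>x\<in>S. w x * c)"
  proof (rule sum_strict_mono_ex1[OF assms(1)])
    show "\<forall>x\<in>S. w x * f x \<le> w x * c"
      using assms(2) less by (auto intro!: mult_left_mono simp: less_imp_le)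
    show "\<exists>x\<in>S. w x * f x < w x * c"
      using less[OF \<open>y \<in> S\<close>] \<open>y \<in> S\<close> \<open>w y > 0\<close> by (intro bexI[of _ y]) auto
  qed
  with assms(4) show False by (simp add: sum_distrib_left mult.commute)
qed

text \<open>
  Every point lies in fewer than \<open>k\<close> of the maximal fibres. A uniformly random set \<open>S\<close> of maximal fibres
  contains the one chosen above \<open>b\<close> and misses those through a point \<open>a\<close> outside it with probability at
  least \<open>1 / 2 ^ k\<close>, which bounds the expected product of the two measures from below.
\<close>

lemma empty_box_of_small_fibres:
  fixes \<mu> :: "'a pmf" and \<nu> :: "'b pmf" and F :: "'b \<Rightarrow> 'a set"
  assumes fin: "finite (set_pmf \<mu>)" "finite (set_pmf \<nu>)"
    and width: "\<And>a \<A>. \<A> \<subseteq> F ` set_pmf \<nu> \<Longrightarrow> antichain \<A> \<Longrightarrow> a \<in> \<Inter>\<A> \<Longrightarrow> card \<A> < k"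
    and half: "measure_pmf.prob \<nu> {b. measure_pmf.prob \<mu> (F b) \<le> 1 / 2} \<ge> 1 / 2"
  obtains X0 Y0 where "X0 \<subseteq> set_pmf \<mu>" "Y0 \<subseteq> set_pmf \<nu>" "\<forall>b\<in>Y0. X0 \<inter> F b = {}"
    "measure_pmf.prob \<mu> X0 * measure_pmf.prob \<nu> Y0 \<ge> 1 / 2 ^ (k + 2)"
proof -
  define A where "A = set_pmf \<mu>"
  define B where "B = {b \<in> set_pmf \<nu>. measure_pmf.prob \<mu> (F b) \<le> 1 / 2}"
  define C where "C = {M \<in> F ` B. \<forall>N\<in>F ` B. M \<subseteq> N \<longrightarrow> M = N}"
  have finA: "finite A" and finB: "finite B" and finC: "finite C"
    using fin by (auto simp: A_def B_def C_def)
  have "\<exists>M\<in>C. F b \<subseteq> M" if "b \<in> B" for b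
    using finite_has_maximal2[of "F ` B" "F b"] that finB by (auto simp: C_def)
  then obtain c where c: "\<And>b. b \<in> B \<Longrightarrow> c b \<in> C" "\<And>b. b \<in> B \<Longrightarrow> F b \<subseteq> c b"
    by metis
  define D where "D a = {M \<in> C. a \<in> M}" for a
  have D: "D a \<subseteq> C" for a by (auto simp: D_def)
  \<comment> \<open>The maximal fibres are pairwise incomparable, and those in \<open>D a\<close>
    share the point \<open>a\<close>, so the width bound applies.\<close>
  have cardD: "card (D a) < k" for a
    by (rule width[of _ a]) (auto simp: D_def C_def B_def antichain_def)
  define X0 where "X0 S = A - \<Union>S" for S
  define Y0 where "Y0 S = {b \<in> B. c b \<in> S}" for S
  have subs: "X0 S \<subseteq> set_pmf \<mu>" "Y0 S \<subseteq> set_pmf \<nu>" for S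
    by (auto simp: X0_def Y0_def A_def B_def)
  have empty: "\<forall>b\<in>Y0 S. X0 S \<inter> F b = {}" for S
    using c(2) by (fastforce simp: X0_def Y0_def)
  have X0: "measure_pmf.prob \<mu> (X0 S) = (\<Sum>a\<in>A. pmf \<mu> a * of_bool (S \<inter> D a = {}))" if "S \<subseteq> C" for S
    unfolding A_def prob_eq_sum[OF fin(1)] using that
    by (intro sum.cong refl arg_cong2[where f = "(*)"] arg_cong[where f = of_bool])
       (auto simp: X0_def D_def A_def)
  have Y0: "measure_pmf.prob \<nu> (Y0 S) = (\<Sum>b\<in>B. pmf \<nu> b * of_bool (c b \<in> S))" for S
    unfolding prob_eq_sum[OF fin(2)] using fin(2)
    by (intro sum.mono_neutral_cong_right) (auto simp: Y0_def B_def)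
  \<comment> \<open>For \<open>a\<close> outside \<open>c b\<close>, the good sets \<open>S\<close>
    contain \<open>c b\<close> and avoid \<open>D a\<close>. This decides
    \<open>Suc (card (D a))\<close> memberships, which is at most \<open>k\<close> by the strict
    bound \<open>cardD\<close>.\<close>
  have count: "of_bool (a \<notin> c b) * (2 ^ card C / 2 ^ k)
      \<le> (\<Sum>S\<in>Pow C. of_bool (S \<inter> D a = {}) * of_bool (c b \<in> S) :: real)" if "b \<in> B" for a b
  proof (cases "a \<in> c b")
    case False
    then have cb: "c b \<in> C - D a" using c(1)[OF that] by (auto simp: D_def)
    have le: "Suc (card (D a)) \<le> card C"
      using cb D[of a] finC by (intro Suc_leI psubset_card_mono) auto
    have "(2::real) ^ card C / 2 ^ k \<le> 2 ^ card C / 2 ^ Suc (card (D a))"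
      using cardD[of a] by (intro divide_left_mono power_increasing) auto
    also have "\<dots> = 2 ^ (card C - Suc (card (D a)))"
      using le by (simp only: power_diff)
    also have "\<dots> = real (card {S \<in> Pow C. c b \<in> S \<and> S \<inter> D a = {}})"
      by (simp only: card_subsets_containing_avoiding[OF finC D cb] of_nat_power of_nat_numeral)
    also have "\<dots> = (\<Sum>S\<in>Pow C. of_bool (c b \<in> S \<and> S \<inter> D a = {}))"
      using finC by (simp add: sum_of_bool_eq Int_def)
    also have "\<dots> = (\<Sum>S\<in>Pow C. of_bool (S \<inter> D a = {}) * of_bool (c b \<in> S))"
      by (intro sum.cong) auto
    finally show ?thesis using False by simp
  qed (simp add: sum_nonneg)
  have small: "(\<Sum>a\<in>A. pmf \<mu> a * of_bool (a \<notin> c b)) \<ge> 1 / 2" if "b \<in> B" for b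
  proof -
    have "measure_pmf.prob \<mu> (c b) \<le> 1 / 2"
      using c(1)[OF that] by (auto simp: C_def B_def)
    then have "measure_pmf.prob \<mu> (- c b) \<ge> 1 / 2"
      using measure_pmf.prob_compl[of "c b" \<mu>] by (simp add: Compl_eq_Diff_UNIV)
    then show ?thesis by (simp add: prob_eq_sum[OF fin(1)] A_def)
  qed
  have sumB: "(\<Sum>b\<in>B. pmf \<nu> b) \<ge> 1 / 2"
  proof -
    have "measure_pmf.prob \<nu> {b. measure_pmf.prob \<mu> (F b) \<le> 1 / 2} = (\<Sum>b\<in>B. pmf \<nu> b)"
      unfolding prob_eq_sum[OF fin(2)] using fin(2)
      by (intro sum.mono_neutral_cong_right) (auto simp: B_def)
    with half show ?thesis by simp
  qed
  \<comment> \<open>The two factors 1/2 are lower bounds for the mass of \<open>B\<close> and for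
    the mass outside a maximal fibre \<open>c b\<close>. The chain replaces them by sums, inserts
    \<open>count\<close> for each pair, and moves the sum over \<open>S\<close> outside.\<close>
  have "1 / 2 ^ (k + 2) * (\<Sum>S\<in>Pow C. (1::real)) = (2 ^ card C / 2 ^ k) * (1 / 2 * (1 / 2))"
    using finC by (simp add: card_Pow power_add)
  also have "\<dots> \<le> (2 ^ card C / 2 ^ k) * (\<Sum>b\<in>B. pmf \<nu> b * (1 / 2))"
    using sumB by (intro mult_left_mono) (simp_all flip: sum_distrib_right sum_divide_distrib)
  also have "\<dots> \<le> (2 ^ card C / 2 ^ k) * (\<Sum>b\<in>B. pmf \<nu> b * (\<Sum>a\<in>A. pmf \<mu> a * of_bool (a \<notin> c b)))"
    using small by (intro mult_left_mono sum_mono) auto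
  also have "\<dots> = (\<Sum>b\<in>B. \<Sum>a\<in>A. pmf \<nu> b * pmf \<mu> a * (of_bool (a \<notin> c b) * (2 ^ card C / 2 ^ k)))"
    by (simp add: sum_distrib_left mult_ac)
  also have "\<dots> \<le> (\<Sum>b\<in>B. \<Sum>a\<in>A. pmf \<nu> b * pmf \<mu> a *
      (\<Sum>S\<in>Pow C. of_bool (S \<inter> D a = {}) * of_bool (c b \<in> S)))"
    using count by (intro sum_mono mult_left_mono) auto
  also have "\<dots> = (\<Sum>b\<in>B. \<Sum>a\<in>A. \<Sum>S\<in>Pow C.
      (pmf \<mu> a * of_bool (S \<inter> D a = {})) * (pmf \<nu> b * of_bool (c b \<in> S)))"
    by (simp add: sum_distrib_left mult_ac)
  also have "\<dots> = (\<Sum>b\<in>B. \<Sum>S\<in>Pow C. \<Sum>a\<in>A.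
      (pmf \<mu> a * of_bool (S \<inter> D a = {})) * (pmf \<nu> b * of_bool (c b \<in> S)))"
    by (intro sum.cong refl sum.swap)
  also have "\<dots> = (\<Sum>S\<in>Pow C. \<Sum>b\<in>B. \<Sum>a\<in>A.
      (pmf \<mu> a * of_bool (S \<inter> D a = {})) * (pmf \<nu> b * of_bool (c b \<in> S)))"
    by (rule sum.swap)
  also have "\<dots> = (\<Sum>S\<in>Pow C. 1 * (measure_pmf.prob \<mu> (X0 S) * measure_pmf.prob \<nu> (Y0 S)))"
    by (intro sum.cong refl, subst sum.swap) (simp add: X0 Y0 sum_product)
  finally obtain S where "1 / 2 ^ (k + 2) \<le> measure_pmf.prob \<mu> (X0 S) * measure_pmf.prob \<nu> (Y0 S)"
    using exists_ge_average[of "Pow C" "\<lambda>_. 1" "1 / 2 ^ (k + 2)"] finC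
    by (auto simp: card_Pow)
  with subs empty show thesis by (rule that)
qed

text \<open>Double counting yields a point \<open>a\<close> whose large fibres have parameters of
  mass at least 1/4. The minimal fibres among these form an antichain through \<open>a\<close>,
  hence are fewer than \<open>k\<close>, and every fibre considered contains one of them. By
  pigeonhole one minimal fibre lies below enough of the others; being itself large, it is the first
  side of the box.\<close>

lemma full_box_of_large_fibres:
  fixes \<mu> :: "'a pmf" and \<nu> :: "'b pmf" and F :: "'b \<Rightarrow> 'a set"
  assumes fin: "finite (set_pmf \<mu>)" "finite (set_pmf \<nu>)"
    and width: "\<And>a \<A>. \<A> \<subseteq> F ` set_pmf \<nu> \<Longrightarrow> antichain \<A> \<Longrightarrow> a \<in> \<Inter>\<A> \<Longrightarrow> card \<A> < k"
    and half: "measure_pmf.prob \<nu> {b. measure_pmf.prob \<mu> (F b) > 1 / 2} \<ge> 1 / 2"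
  obtains X0 Y0 where "X0 \<in> F ` set_pmf \<nu>" "Y0 \<subseteq> set_pmf \<nu>" "\<forall>b\<in>Y0. X0 \<subseteq> F b"
    "measure_pmf.prob \<mu> X0 > 1 / 2" "measure_pmf.prob \<nu> Y0 \<ge> 1 / (4 * real k)"
proof -
  define A where "A = set_pmf \<mu>"
  define B where "B = {b \<in> set_pmf \<nu>. measure_pmf.prob \<mu> (F b) > 1 / 2}"
  have finA: "finite A" and finB: "finite B"
    using fin by (auto simp: A_def B_def)
  have nuB: "measure_pmf.prob \<nu> {b \<in> B. P b} = (\<Sum>b\<in>B. pmf \<nu> b * of_bool (P b))" for P
    unfolding prob_eq_sum[OF fin(2)] using fin(2)
    by (intro sum.mono_neutral_cong_right) (auto simp: B_def)
  have sumB: "(\<Sum>b\<in>B. pmf \<nu> b) \<ge> 1 / 2"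
  proof -
    have "measure_pmf.prob \<nu> {b. measure_pmf.prob \<mu> (F b) > 1 / 2} = (\<Sum>b\<in>B. pmf \<nu> b)"
      unfolding prob_eq_sum[OF fin(2)] using fin(2)
      by (intro sum.mono_neutral_cong_right) (auto simp: B_def)
    with half show ?thesis by simp
  qed
  have sumA: "(\<Sum>a\<in>A. pmf \<mu> a) = 1"
    using fin(1) by (simp add: A_def sum_pmf_eq_1)
  \<comment> \<open>Exchanging the sums turns the total measure of the fibres over \<open>B\<close>
    into an average over \<open>a\<close> of the mass of the parameters whose fibre contains
    \<open>a\<close>. Half of the parameters times half of the points gives 1/4.\<close>
  have "1 / 4 * (\<Sum>a\<in>A. pmf \<mu> a) \<le> (\<Sum>b\<in>B. pmf \<nu> b * (1 / 2))"
    using sumB by (simp add: sumA flip: sum_divide_distrib)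
  also have "\<dots> \<le> (\<Sum>b\<in>B. pmf \<nu> b * measure_pmf.prob \<mu> (F b))"
    by (intro sum_mono mult_left_mono) (auto simp: B_def)
  also have "\<dots> = (\<Sum>b\<in>B. \<Sum>a\<in>A. pmf \<mu> a * (pmf \<nu> b * of_bool (a \<in> F b)))"
    by (simp add: prob_eq_sum[OF fin(1)] A_def sum_distrib_left mult_ac)
  also have "\<dots> = (\<Sum>a\<in>A. pmf \<mu> a * measure_pmf.prob \<nu> {b \<in> B. a \<in> F b})"
    by (subst sum.swap) (simp add: nuB sum_distrib_left)
  finally obtain a where a: "1 / 4 \<le> measure_pmf.prob \<nu> {b \<in> B. a \<in> F b}"
    using exists_ge_average[of A "pmf \<mu>" "1 / 4"] finA sumA by fastforce
  define G where "G = {b \<in> B. a \<in> F b}"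
  define C where "C = {M \<in> F ` G. \<forall>N\<in>F ` G. N \<subseteq> M \<longrightarrow> M = N}"
  have finG: "finite G" and finC: "finite C"
    using finB by (auto simp: G_def C_def)
  have cardC: "card C < k"
    by (rule width[of _ a]) (auto simp: C_def G_def B_def antichain_def)
  have cover: "\<exists>M\<in>C. M \<subseteq> F b" if "b \<in> G" for b
    using finite_has_minimal2[of "F ` G" "F b"] that finG by (auto simp: C_def)
  have "G \<noteq> {}" using a by (auto simp flip: G_def)
  then have "C \<noteq> {}" using cover by auto
  have "measure_pmf.prob \<nu> G \<le> measure_pmf.prob \<nu> (\<Union>M\<in>C. {b \<in> G. M \<subseteq> F b})"
    using cover by (intro measure_pmf.finite_measure_mono) auto
  also have "\<dots> \<le> (\<Sum>M\<in>C. measure_pmf.prob \<nu> {b \<in> G. M \<subseteq> F b})"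
    using finC by (intro measure_pmf.finite_measure_subadditive_finite) auto
  finally have G: "1 / 4 \<le> (\<Sum>M\<in>C. measure_pmf.prob \<nu> {b \<in> G. M \<subseteq> F b})"
    using a by (simp add: G_def)
  have "1 / (4 * real k) * real (card C) \<le> 1 / 4"
    using cardC by (simp add: field_simps)
  with G have "1 / (4 * real k) * (\<Sum>M\<in>C. 1) \<le> (\<Sum>M\<in>C. 1 * measure_pmf.prob \<nu> {b \<in> G. M \<subseteq> F b})"
    by simp
  then obtain M where M: "M \<in> C" "1 / (4 * real k) \<le> measure_pmf.prob \<nu> {b \<in> G. M \<subseteq> F b}"
    using exists_ge_average[of C "\<lambda>_. 1" "1 / (4 * real k)"] finC \<open>C \<noteq> {}\<close>
    by (auto simp: card_gt_0_iff)
  show thesis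
  proof (rule that)
    show "M \<in> F ` set_pmf \<nu>" "measure_pmf.prob \<mu> M > 1 / 2"
      using M(1) by (auto simp: C_def G_def B_def)
  qed (use M in \<open>auto simp: G_def B_def\<close>)
qed

text \<open>Either the small or the large fibres carry at least half of \<open>\<nu>\<close>, and
  each case supplies a homogeneous box with bounds depending on \<open>k\<close> alone.\<close>

lemma sEH_of_bounded_antichains:
  assumes width: "\<And>a \<A>. \<A> \<subseteq> (\<lambda>b. {a \<in> X. (a, b) \<in> E}) ` Y \<Longrightarrow> finite \<A> \<Longrightarrow> antichain \<A> \<Longrightarrow>
      a \<in> \<Inter>\<A> \<Longrightarrow> card \<A> < k"
  shows "sEH X Y E"
  unfolding sEH_def
\<comment> \<open>This constant is strictly below \<open>1 / 2 ^ (k + 2)\<close> and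
  \<open>1 / (4 * real k)\<close>, the bounds from the two cases, as \<open>sEH\<close> asks for
  strict inequalities.\<close>
proof (intro exI[of _ "1 / 2 ^ (k + 3)"] conjI allI impI)
  fix \<mu> :: "'a pmf" and \<nu> :: "'b pmf"
  assume asm: "finite (set_pmf \<mu>) \<and> set_pmf \<mu> \<subseteq> X \<and> finite (set_pmf \<nu>) \<and> set_pmf \<nu> \<subseteq> Y"
  then have fin: "finite (set_pmf \<mu>)" "finite (set_pmf \<nu>)" by auto
  let ?F = "\<lambda>b. {a \<in> X. (a, b) \<in> E}"
  let ?B = "{b. measure_pmf.prob \<mu> (?F b) \<le> 1 / 2}"
  have width': "card \<A> < k" if "\<A> \<subseteq> ?F ` set_pmf \<nu>" "antichain \<A>" "a \<in> \<Inter>\<A>" for a \<A>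
    using that asm finite_subset[OF that(1)] by (intro width[of \<A> a]) blast+
  \<comment> \<open>Every point lies in the intersection of the empty family, so the width bound
    says \<open>0 < k\<close>.\<close>
  have "k > 0" using width[of "{}"] by (auto simp: antichain_def)
  show "\<exists>X0 Y0. X0 \<subseteq> X \<and> Y0 \<subseteq> Y \<and>
      1 / 2 ^ (k + 3) < measure_pmf.prob \<mu> X0 \<and> 1 / 2 ^ (k + 3) < measure_pmf.prob \<nu> Y0 \<and>
      (X0 \<times> Y0 \<subseteq> E \<or> X0 \<times> Y0 \<inter> E = {})"
  proof (cases "measure_pmf.prob \<nu> ?B \<ge> 1 / 2")
    case True
    obtain X0 Y0 where *: "X0 \<subseteq> set_pmf \<mu>" "Y0 \<subseteq> set_pmf \<nu>" "\<forall>b\<in>Y0. X0 \<inter> ?F b = {}"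
      "measure_pmf.prob \<mu> X0 * measure_pmf.prob \<nu> Y0 \<ge> 1 / 2 ^ (k + 2)"
      by (rule empty_box_of_small_fibres[OF fin width' True])
    have "(1::real) / 2 ^ (k + 3) < 1 / 2 ^ (k + 2)"
      by (simp add: field_simps power_add)
    \<comment> \<open>Probabilities are at most 1, so a lower bound on the product bounds each
      factor.\<close>
    moreover have "measure_pmf.prob \<mu> X0 * measure_pmf.prob \<nu> Y0 \<le> measure_pmf.prob \<mu> X0"
      "measure_pmf.prob \<mu> X0 * measure_pmf.prob \<nu> Y0 \<le> measure_pmf.prob \<nu> Y0"
      by (simp_all add: mult_left_le mult_left_le_one_le)
    moreover have "X0 \<times> Y0 \<inter> E = {}" using * asm by blast
    ultimately show ?thesis using * asm
      by (intro exI[of _ X0] exI[of _ Y0]) auto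
  next
    case False
    have "{b. measure_pmf.prob \<mu> (?F b) > 1 / 2} = - ?B" by auto
    then have large: "measure_pmf.prob \<nu> {b. measure_pmf.prob \<mu> (?F b) > 1 / 2} \<ge> 1 / 2"
      using False measure_pmf.prob_compl[of ?B \<nu>] by (simp add: Compl_eq_Diff_UNIV)
    obtain X0 Y0 where *: "X0 \<in> ?F ` set_pmf \<nu>" "Y0 \<subseteq> set_pmf \<nu>" "\<forall>b\<in>Y0. X0 \<subseteq> ?F b"
      "measure_pmf.prob \<mu> X0 > 1 / 2" "measure_pmf.prob \<nu> Y0 \<ge> 1 / (4 * real k)"
      by (rule full_box_of_large_fibres[OF fin width' large])
    have "real k < 2 * 2 ^ k"
      using of_nat_less_two_power[of k, where 'a = real] of_nat_0_le_iff[of k, where 'a = real] by linarith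
    then have "(1::real) / 2 ^ (k + 3) < 1 / (4 * real k)"
      using \<open>k > 0\<close> by (simp add: field_simps power_add)
    moreover have "(1::real) / 2 ^ (k + 3) \<le> 1 / 2 ^ 1"
      by (intro divide_left_mono power_increasing) auto
    then have "(1::real) / 2 ^ (k + 3) \<le> 1 / 2"
      by (simp only: power_one_right)
    ultimately have "1 / 2 ^ (k + 3) < measure_pmf.prob \<mu> X0" "1 / 2 ^ (k + 3) < measure_pmf.prob \<nu> Y0"
      using *(4,5) by linarith+
    moreover have "X0 \<subseteq> X" "Y0 \<subseteq> Y" "X0 \<times> Y0 \<subseteq> E"
      using *(1-3) asm by blast+
    ultimately show ?thesis by blast
  qed
qed simp

section \<open>Closure of the strong EH property under Boolean operations\<close>

lemma sEH_Compl:
  assumes "sEH X Y E"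
  shows "sEH X Y (X \<times> Y - E)"
proof -
  obtain \<beta> where "\<beta> > 0" and E: "\<forall>(\<mu> :: 'a pmf) (\<nu> :: 'b pmf).
        finite (set_pmf \<mu>) \<and> set_pmf \<mu> \<subseteq> X \<and> finite (set_pmf \<nu>) \<and> set_pmf \<nu> \<subseteq> Y \<longrightarrow>
        (\<exists>X0 Y0. X0 \<subseteq> X \<and> Y0 \<subseteq> Y \<and> measure_pmf.prob \<mu> X0 > \<beta> \<and> measure_pmf.prob \<nu> Y0 > \<beta> \<and>
          (X0 \<times> Y0 \<subseteq> E \<or> (X0 \<times> Y0) \<inter> E = {}))"
    using assms unfolding sEH_def by (elim exE conjE) (rule that)
  show ?thesis
    unfolding sEH_def
  proof (intro exI[of _ \<beta>] conjI allI impI)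
    fix \<mu> :: "'a pmf" and \<nu> :: "'b pmf"
    assume "finite (set_pmf \<mu>) \<and> set_pmf \<mu> \<subseteq> X \<and> finite (set_pmf \<nu>) \<and> set_pmf \<nu> \<subseteq> Y"
    from E[rule_format, OF this] obtain X0 Y0 where
        0: "X0 \<subseteq> X" "Y0 \<subseteq> Y" "measure_pmf.prob \<mu> X0 > \<beta>" "measure_pmf.prob \<nu> Y0 > \<beta>"
        "X0 \<times> Y0 \<subseteq> E \<or> (X0 \<times> Y0) \<inter> E = {}"
      by blast
    then have "X0 \<times> Y0 \<subseteq> X \<times> Y - E \<or> X0 \<times> Y0 \<inter> (X \<times> Y - E) = {}"
      by blast
    with 0 show "\<exists>X0 Y0. X0 \<subseteq> X \<and> Y0 \<subseteq> Y \<and> \<beta> < measure_pmf.prob \<mu> X0 \<and>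
        \<beta> < measure_pmf.prob \<nu> Y0 \<and> (X0 \<times> Y0 \<subseteq> X \<times> Y - E \<or> X0 \<times> Y0 \<inter> (X \<times> Y - E) = {})"
      by (intro exI[of _ X0] exI[of _ Y0] conjI)
  qed fact
qed

lemma prob_cond_pmf:
  assumes "set_pmf p \<inter> S \<noteq> {}"
  shows "measure_pmf.prob (cond_pmf p S) A = measure_pmf.prob p (S \<inter> A) / measure_pmf.prob p S"
proof -
  have "measure_pmf.prob (cond_pmf p S) A = measure (uniform_measure (measure_pmf p) S) A"
    by (simp add: cond_pmf.rep_eq[OF assms])
  also have "\<dots> = measure_pmf.prob p (S \<inter> A) / measure_pmf.prob p S"
    using measure_measure_pmf_not_zero[OF assms]
    by (intro measure_uniform_measure) (auto simp: measure_pmf.emeasure_eq_measure)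
  finally show ?thesis .
qed

text \<open>The measures are conditioned on the sides of a homogeneous box for \<open>E\<close>, and
  a homogeneous box for \<open>F\<close> is taken with respect to the conditioned measures.
  Intersecting the sides keeps both kinds of homogeneity, and the constants multiply.\<close>

lemma sEH_Int:
  assumes "sEH X Y E" "sEH X Y F"
  shows "sEH X Y (E \<inter> F)"
proof -
  obtain \<beta> where "\<beta> > 0" and E: "\<forall>(\<mu> :: 'a pmf) (\<nu> :: 'b pmf).
        finite (set_pmf \<mu>) \<and> set_pmf \<mu> \<subseteq> X \<and> finite (set_pmf \<nu>) \<and> set_pmf \<nu> \<subseteq> Y \<longrightarrow>
        (\<exists>X0 Y0. X0 \<subseteq> X \<and> Y0 \<subseteq> Y \<and> measure_pmf.prob \<mu> X0 > \<beta> \<and> measure_pmf.prob \<nu> Y0 > \<beta> \<and>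
          (X0 \<times> Y0 \<subseteq> E \<or> (X0 \<times> Y0) \<inter> E = {}))"
    using assms(1) unfolding sEH_def by (elim exE conjE) (rule that)
  obtain \<gamma> where "\<gamma> > 0" and F: "\<forall>(\<mu> :: 'a pmf) (\<nu> :: 'b pmf).
        finite (set_pmf \<mu>) \<and> set_pmf \<mu> \<subseteq> X \<and> finite (set_pmf \<nu>) \<and> set_pmf \<nu> \<subseteq> Y \<longrightarrow>
        (\<exists>X0 Y0. X0 \<subseteq> X \<and> Y0 \<subseteq> Y \<and> measure_pmf.prob \<mu> X0 > \<gamma> \<and> measure_pmf.prob \<nu> Y0 > \<gamma> \<and>
          (X0 \<times> Y0 \<subseteq> F \<or> (X0 \<times> Y0) \<inter> F = {}))"
    using assms(2) unfolding sEH_def by (elim exE conjE) (rule that)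
  then have pos: "\<beta> > 0" "\<gamma> > 0" using \<open>\<beta> > 0\<close> by auto
  \<comment> \<open>Stated over a separate type \<open>'c\<close>, so that it serves for
    \<open>\<mu>\<close> as well as for \<open>\<nu>\<close>.\<close>
  have restrict: "set_pmf (cond_pmf p S) = set_pmf p \<inter> S"
      "\<gamma> < measure_pmf.prob (cond_pmf p S) A \<Longrightarrow> \<beta> * \<gamma> < measure_pmf.prob p (S \<inter> A)"
    if "\<beta> < measure_pmf.prob p S" for p :: "'c pmf" and S A
  proof -
    have "set_pmf p \<inter> S \<noteq> {}"
      using that pos(1) by (metis less_asym measure_Int_set_pmf measure_empty Int_commute)
    then show "set_pmf (cond_pmf p S) = set_pmf p \<inter> S" by (rule set_cond_pmf)
    assume "\<gamma> < measure_pmf.prob (cond_pmf p S) A"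
    then have "\<gamma> * measure_pmf.prob p S < measure_pmf.prob p (S \<inter> A)"
      using that pos(1) by (simp add: prob_cond_pmf[OF \<open>set_pmf p \<inter> S \<noteq> {}\<close>] pos_less_divide_eq)
    moreover have "\<beta> * \<gamma> \<le> \<gamma> * measure_pmf.prob p S"
      using that pos by (simp add: mult.commute)
    ultimately show "\<beta> * \<gamma> < measure_pmf.prob p (S \<inter> A)" by linarith
  qed
  show ?thesis
    unfolding sEH_def
  proof (intro exI[of _ "\<beta> * \<gamma>"] conjI allI impI)
    fix \<mu> :: "'a pmf" and \<nu> :: "'b pmf"
    assume asm: "finite (set_pmf \<mu>) \<and> set_pmf \<mu> \<subseteq> X \<and> finite (set_pmf \<nu>) \<and> set_pmf \<nu> \<subseteq> Y"
    obtain X0 Y0 where 0: "X0 \<subseteq> X" "Y0 \<subseteq> Y" "measure_pmf.prob \<mu> X0 > \<beta>" "measure_pmf.prob \<nu> Y0 > \<beta>"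
        "X0 \<times> Y0 \<subseteq> E \<or> (X0 \<times> Y0) \<inter> E = {}"
      using E[rule_format, OF asm] by blast
    have "finite (set_pmf (cond_pmf \<mu> X0)) \<and> set_pmf (cond_pmf \<mu> X0) \<subseteq> X \<and>
        finite (set_pmf (cond_pmf \<nu> Y0)) \<and> set_pmf (cond_pmf \<nu> Y0) \<subseteq> Y"
      using asm 0(1,2) restrict(1)[OF 0(3)] restrict(1)[OF 0(4)] by auto
    from F[rule_format, OF this] obtain X1 Y1 where 1: "X1 \<subseteq> X" "Y1 \<subseteq> Y"
        "measure_pmf.prob (cond_pmf \<mu> X0) X1 > \<gamma>" "measure_pmf.prob (cond_pmf \<nu> Y0) Y1 > \<gamma>"
        "X1 \<times> Y1 \<subseteq> F \<or> (X1 \<times> Y1) \<inter> F = {}"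
      by blast
    show "\<exists>X0 Y0. X0 \<subseteq> X \<and> Y0 \<subseteq> Y \<and> \<beta> * \<gamma> < measure_pmf.prob \<mu> X0 \<and>
        \<beta> * \<gamma> < measure_pmf.prob \<nu> Y0 \<and> (X0 \<times> Y0 \<subseteq> E \<inter> F \<or> X0 \<times> Y0 \<inter> (E \<inter> F) = {})"
    proof (intro exI conjI)
      show "X0 \<inter> X1 \<subseteq> X" "Y0 \<inter> Y1 \<subseteq> Y" using 0(1,2) by auto
      show "\<beta> * \<gamma> < measure_pmf.prob \<mu> (X0 \<inter> X1)" by (rule restrict(2)[OF 0(3) 1(3)])
      show "\<beta> * \<gamma> < measure_pmf.prob \<nu> (Y0 \<inter> Y1)" by (rule restrict(2)[OF 0(4) 1(4)])
      show "(X0 \<inter> X1) \<times> (Y0 \<inter> Y1) \<subseteq> E \<inter> F \<or> (X0 \<inter> X1) \<times> (Y0 \<inter> Y1) \<inter> (E \<inter> F) = {}"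
        using 0(5) 1(5) by blast
    qed
  qed (use pos in simp)
qed

section \<open>Transfer of entailment to models on arbitrary types\<close>

lemma eval_trm_cong: "(\<And>z. z \<in> fv_trm t \<Longrightarrow> v z = w z) \<Longrightarrow> eval_trm M v t = eval_trm M w t"
proof (induction t)
  case (Fn f ts)
  have "eval_trm M v t = eval_trm M w t" if "t \<in> set ts" for t
    by (rule Fn.IH[OF that], rule Fn.prems) (use that in auto)
  then have "map (eval_trm M v) ts = map (eval_trm M w) ts" by simp
  then show ?case by (simp only: eval_trm.simps)
qed simp

lemma sat_cong: "(\<And>z. z \<in> fv \<phi> \<Longrightarrow> v z = w z) \<Longrightarrow> sat M v \<phi> \<longleftrightarrow> sat M w \<phi>"
proof (induction \<phi> arbitrary: v w)
  case (Eql t u)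
  then show ?case using eval_trm_cong[of t v w M] eval_trm_cong[of u v w M] by auto
next
  case (Rel r ts)
  then have "map (eval_trm M v) ts = map (eval_trm M w) ts"
    by (auto intro!: eval_trm_cong)
  then show ?case by (simp only: sat.simps)
next
  case (Conj \<phi> \<psi>)
  have "sat M v \<phi> \<longleftrightarrow> sat M w \<phi>" by (rule Conj.IH) (simp add: Conj.prems)
  moreover have "sat M v \<psi> \<longleftrightarrow> sat M w \<psi>" by (rule Conj.IH) (simp add: Conj.prems)
  ultimately show ?case by simp
next
  case (Ex z \<phi>)
  have "sat M (v(z := a)) \<phi> \<longleftrightarrow> sat M (w(z := a)) \<phi>" for a
    by (rule Ex.IH) (simp add: Ex.prems)
  then show ?case by simp
next
  case (Neg \<phi>)
  have "sat M v \<phi> \<longleftrightarrow> sat M w \<phi>" by (rule Neg.IH) (simp add: Neg.prems)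
  then show ?case by simp
qed

lemma finite_fv_trm: "finite (fv_trm t)"
  by (induction t) auto

lemma finite_fv: "finite (fv \<phi>)"
  by (induction \<phi>) (auto simp: finite_fv_trm)

lemma valuationD: "valuation M v \<Longrightarrow> v z \<in> univ M (snd z)"
  by (simp only: valuation_def)

section \<open>Skolem hulls coded by formulas\<close>

text \<open>A Skolem function taking the whole valuation as argument. Where no witness exists its
  value may lie outside every universe, so hulls are always intersected with a universe when
  used.\<close>

definition witness ::
  "('f, 'r, 's, 'a) interp \<Rightarrow> ('s var \<Rightarrow> 'a) \<Rightarrow> 's var \<Rightarrow> ('f, 'r, 's) fm \<Rightarrow> 'a" where
  "witness M w z \<phi> = (SOME a. a \<in> univ M (snd z) \<and> sat M (w(z := a)) \<phi>)"

lemma witness: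
  assumes "a \<in> univ M (snd z)" "sat M (w(z := a)) \<phi>"
  shows "witness M w z \<phi> \<in> univ M (snd z)" "sat M (w(z := witness M w z \<phi>)) \<phi>"
  using someI[of "\<lambda>a. a \<in> univ M (snd z) \<and> sat M (w(z := a)) \<phi>" a] assms
  unfolding witness_def by blast+

text \<open>
  The valuations obtained from \<open>v\<close> by finitely many assignments of values already reached and of
  Skolem witnesses. Each derivation is recorded by a formula, used merely as a code, so that the
  Skolem hull of \<open>v\<close> is an image of the type of formulas.
\<close>

inductive named ::
  "('f, 'r, 's, 'a) interp \<Rightarrow> ('s var \<Rightarrow> 'a) \<Rightarrow> ('f, 'r, 's) fm \<Rightarrow> ('s var \<Rightarrow> 'a) \<Rightarrow> bool"
  for M v where
  start: "named M v (Eql t u) v"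
| assign: "named M v c w \<Longrightarrow> named M v d w' \<Longrightarrow>
    named M v (Conj (Conj c d) (Eql (Var z) (Var y))) (w(z := w' y))"
| wit: "named M v c w \<Longrightarrow> named M v (Conj c (Ex z \<phi>)) (w(z := witness M w z \<phi>))"

inductive_cases named_EqlE: "named M v (Eql t u) w"
inductive_cases named_assignE: "named M v (Conj c (Eql t u)) w"
inductive_cases named_witE: "named M v (Conj c (Ex z \<phi>)) w"

text \<open>The three rules produce codes of different shapes, and each code displays the codes and
  variables used, so a derivation can be read back. This makes decoding a function.\<close>

lemma named_unique:
  fixes M :: "('f, 'r, 's, 'a) interp"
  shows "named M v c w \<Longrightarrow> named M v c w' \<Longrightarrow> w = w'"
proof (induction arbitrary: w' rule: named.induct)
  case (start t u)
  from start.prems show ?case by (rule named_EqlE) (rule sym)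
next
  case (assign c w d x z y)
  from assign.prems show ?case
  proof (rule named_assignE)
    fix c' d' w1 w2 z' y'
    assume *: "w' = w1(z' := w2 y')" "named M v c' w1" "named M v d' w2" "Conj c d = Conj c' d'"
      "Var z = (Var z' :: ('f, 's) trm)" "Var y = (Var y' :: ('f, 's) trm)"
    have "named M v c w1" "named M v d w2" using *(2-4) by simp_all
    then have "w = w1" "x = w2" by (simp_all only: assign.IH)
    with * show "w(z := x y) = w'" by simp
  qed
next
  case (wit c w z \<phi>)
  from wit.prems show ?case
  proof (rule named_witE)
    fix w1 assume "w' = w1(z := witness M w1 z \<phi>)" "named M v c w1"
    with wit.IH show "w(z := witness M w z \<phi>) = w'" by blast
  qed
qed

definition skolem_hull :: "('f, 'r, 's, 'a) interp \<Rightarrow> ('s var \<Rightarrow> 'a) \<Rightarrow> 'a set" where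
  "skolem_hull M v = {w z | c w z. named M v c w}"

lemma named_in_skolem_hull: "named M v c w \<Longrightarrow> w z \<in> skolem_hull M v"
  unfolding skolem_hull_def by blast

lemma start_in_skolem_hull: "v z \<in> skolem_hull M v"
  using named_in_skolem_hull[OF named.start] .

text \<open>A hull element is given by a code \<open>c\<close> and a variable \<open>z\<close>; the
  formula \<open>Ex z c\<close> packs both into one. On formulas that are no such code
  \<open>g\<close> is arbitrary, whence only an inclusion.\<close>

lemma skolem_hull_subset_range:
  fixes M :: "('f, 'r, 's, 'a) interp"
  shows "\<exists>g :: ('f, 'r, 's) fm \<Rightarrow> 'a. skolem_hull M v \<subseteq> range g"
proof -
  define g :: "('f, 'r, 's) fm \<Rightarrow> 'a"
    where "g d = (SOME a. \<exists>z c w. d = Ex z c \<and> named M v c w \<and> a = w z)" for d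
  have g: "g (Ex z c) = w z" if "named M v c w" for z c w
    unfolding g_def
  proof (rule some_equality)
    show "\<exists>z' c' w'. Ex z c = Ex z' c' \<and> named M v c' w' \<and> w z = w' z'"
      using that by blast
    fix a assume "\<exists>z' c' w'. Ex z c = Ex z' c' \<and> named M v c' w' \<and> a = w' z'"
    then obtain w' where "named M v c w'" "a = w' z" by blast
    with named_unique[OF that] show "a = w z" by simp
  qed
  have "skolem_hull M v \<subseteq> range g"
  proof
    fix a assume "a \<in> skolem_hull M v"
    then obtain c w z where "named M v c w" "a = w z"
      unfolding skolem_hull_def by blast
    then have "a = g (Ex z c)" by (simp only: g)
    then show "a \<in> range g" by (rule range_eqI)
  qed
  then show ?thesis by - (rule exI[of _ g])
qed

text \<open>A valuation with values in the hull may itself have no name, but a named one can be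
  corrected at one variable after another by \<open>assign\<close>. Its second premise fetches the
  value from whatever named valuation attains it.\<close>

lemma named_agreeing:
  assumes "finite Z" "\<And>z. z \<in> Z \<Longrightarrow> w z \<in> skolem_hull M v"
  shows "\<exists>c w'. named M v c w' \<and> (\<forall>z\<in>Z. w' z = w z)"
  using assms
proof (induction Z)
  case empty
  show ?case using named.start[of M v] by (intro exI conjI) auto
next
  case (insert z Z)
  then obtain c w' where 1: "named M v c w'" "\<forall>y\<in>Z. w' y = w y" by auto
  obtain d w'' y where 2: "named M v d w''" "w z = w'' y"
    using insert.prems[of z] unfolding skolem_hull_def by blast
  show ?case
  proof (intro exI conjI)
    show "named M v (Conj (Conj c d) (Eql (Var z) (Var y))) (w'(z := w'' y))"
      by (rule named.assign[OF 1(1) 2(1)])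
    show "\<forall>x\<in>insert z Z. (w'(z := w'' y)) x = w x"
      using 1(2) 2(2) by simp
  qed
qed

text \<open>The Tarski-Vaught criterion for the hull. Only the finitely many free variables of
  \<open>\<phi>\<close> matter, so \<open>w\<close> may be replaced by a named valuation, whose
  chosen witness enters the hull through \<open>wit\<close>.\<close>

lemma witness_in_skolem_hull:
  fixes M :: "('f, 'r, 's, 'a) interp" and \<phi> :: "('f, 'r, 's) fm"
  assumes w: "\<And>y. w y \<in> skolem_hull M v" and a: "a \<in> univ M (snd z)" "sat M (w(z := a)) \<phi>"
  shows "\<exists>b \<in> skolem_hull M v \<inter> univ M (snd z). sat M (w(z := b)) \<phi>"
proof -
  obtain c w' where c: "named M v c w'" and w': "\<forall>y\<in>fv \<phi>. w' y = w y"
    using named_agreeing[of "fv \<phi>" w M v, OF finite_fv w] by (elim exE conjE)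
  have agree: "sat M (w'(z := b)) \<phi> \<longleftrightarrow> sat M (w(z := b)) \<phi>" for b
    using w' by (intro sat_cong) auto
  let ?b = "witness M w' z \<phi>"
  have "?b \<in> univ M (snd z)" "sat M (w'(z := ?b)) \<phi>"
    using witness[of a M z w' \<phi>] a agree by auto
  moreover have "?b \<in> skolem_hull M v"
  proof -
    have "named M v (Conj c (Ex z \<phi>)) (w'(z := ?b))" by (rule named.wit[OF c])
    from named_in_skolem_hull[OF this, of z] show ?thesis by simp
  qed
  ultimately show ?thesis using agree by blast
qed

text \<open>Closure under function symbols is not built into \<open>named\<close>: the value of
  \<open>f\<close> is the only solution of an equation \<open>z = f(...)\<close>, so the
  Tarski-Vaught criterion provides it.\<close>

lemma fint_in_skolem_hull:
  fixes M :: "('f, 'r, 's, 'a) interp"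
  assumes M: "is_structure L M" "f \<in> funs L"
    and as: "list_all2 (\<lambda>a s. a \<in> skolem_hull M v \<inter> univ M s) as (fdom L f)"
  shows "fint M f as \<in> skolem_hull M v \<inter> univ M (fcod L f)"
proof -
  define n where "n = length as"
  \<comment> \<open>Starting the numbering at 1 keeps the argument variables apart from
    \<open>z\<close>, which has number 0, even if the sorts agree; \<open>w\<close> undoes the shift
    by \<open>fst y - 1\<close>.\<close>
  define x :: "nat \<Rightarrow> 's var" where "x i = (Suc i, fdom L f ! i)" for i
  define z where "z = (0 :: nat, fcod L f)"
  define w where "w y = (if y \<in> x ` {..<n} then as ! (fst y - 1) else v y)" for y
  have as_i: "as ! i \<in> skolem_hull M v" if "i < n" for i
    using as that by (auto simp: n_def list_all2_conv_all_nth)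
  then have w: "w y \<in> skolem_hull M v" for y
    by (auto simp: w_def x_def start_in_skolem_hull)
  let ?t = "Fn f (map (Var \<circ> x) [0..<n])"
  have "map (w(z := b) \<circ> x) [0..<n] = as" for b
    by (rule nth_equalityI) (auto simp: n_def w_def x_def z_def)
  then have eval: "eval_trm M (w(z := b)) ?t = fint M f as" for b
    by (simp add: comp_def)
  have "list_all2 (\<lambda>a s. a \<in> univ M s) as (fdom L f)"
    using as by (rule list_all2_mono) auto
  then have "fint M f as \<in> univ M (snd z)"
    using M by (auto simp: is_structure_def z_def)
  moreover have sat: "sat M (w(z := b)) (Eql (Var z) ?t) \<longleftrightarrow> b = fint M f as" for b
    by (simp only: sat.simps eval eval_trm.simps(1) fun_upd_same)
  ultimately have "\<exists>b \<in> skolem_hull M v \<inter> univ M (snd z). sat M (w(z := b)) (Eql (Var z) ?t)"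
    by (intro witness_in_skolem_hull[OF w]) (simp_all only:)
  then show ?thesis
    unfolding sat by (simp add: z_def)
qed

text \<open>The structure on the Skolem hull is copied onto codes, and decoding by \<open>g\<close>
  becomes an elementary embedding. The valuation is carried along so that a counterexample with free
  variables survives.\<close>

theorem downward_Loewenheim_Skolem:
  fixes M :: "('f, 'r, 's, 'a) interp"
  assumes M: "is_structure L M" and v: "valuation M v"
  obtains N :: "('f, 'r, 's, ('f, 'r, 's) fm) interp" and v'
  where "is_structure L N" "valuation N v'"
    "\<forall>\<phi>. wf_fm L \<phi> \<longrightarrow> (sat N v' \<phi> \<longleftrightarrow> sat M v \<phi>)"
    "\<forall>\<phi>. wf_fm L \<phi> \<longrightarrow> valid_in M \<phi> \<longrightarrow> valid_in N \<phi>"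
proof -
  define H where "H = skolem_hull M v"
  obtain g :: "('f, 'r, 's) fm \<Rightarrow> 'a" where g: "H \<subseteq> range g"
    using skolem_hull_subset_range[of M v] by (auto simp: H_def)
  \<comment> \<open>\<open>e\<close> picks one code for each hull element. It is inverted by
    \<open>g\<close> on \<open>H\<close>, hence injective there, so equality is preserved.\<close>
  define e where "e = inv g"
  have ge: "g (e a) = a" if "a \<in> H" for a
    using g that by (auto simp: e_def f_inv_into_f)
  define N where "N = \<lparr>univ = \<lambda>s. e ` (H \<inter> univ M s),
    fint = \<lambda>f cs. e (fint M f (map g cs)), rint = \<lambda>r cs. rint M r (map g cs)\<rparr>"
  have interp_N: "fint N f cs = e (fint M f (map g cs))" "rint N r cs \<longleftrightarrow> rint M r (map g cs)" for f r cs
    by (simp_all add: N_def)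
  have g_univ: "g c \<in> H \<inter> univ M s" if "c \<in> univ N s" for c s
    using that by (auto simp: N_def ge)
  have e_univ: "e a \<in> univ N s" if "a \<in> H \<inter> univ M s" for a s
    using that by (auto simp: N_def)
  have fint: "fint M f as \<in> H \<inter> univ M (fcod L f)"
    if "f \<in> funs L" "list_all2 (\<lambda>a s. a \<in> H \<inter> univ M s) as (fdom L f)" for f as
    using fint_in_skolem_hull[OF M that(1)] that(2) by (auto simp: H_def)
  have val: "valuation N (e \<circ> v)"
    unfolding valuation_def comp_def using e_univ valuationD[OF v] start_in_skolem_hull[of v _ M]
    by (blast intro: H_def[THEN equalityD2, THEN subsetD])
  have gv: "g \<circ> (e \<circ> v) = v"
    using ge start_in_skolem_hull[of v _ M] by (auto simp: H_def)
  have gval: "valuation M (g \<circ> w)" if "valuation N w" for w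
    unfolding valuation_def comp_def using g_univ valuationD[OF that] by blast
  have struct: "is_structure L N"
    unfolding is_structure_def
  proof (intro conjI allI ballI impI)
    fix s
    \<comment> \<open>The value of \<open>v\<close> at any variable of sort \<open>s\<close> is in
      the hull, so no sort becomes empty.\<close>
    have "(e \<circ> v) (0, s) \<in> univ N s" using valuationD[OF val, of "(0, s)"] by simp
    then show "univ N s \<noteq> {}" by blast
  next
    fix f cs assume f: "f \<in> funs L" and cs: "list_all2 (\<lambda>a s. a \<in> univ N s) cs (fdom L f)"
    have "list_all2 (\<lambda>a s. a \<in> H \<inter> univ M s) (map g cs) (fdom L f)"
      unfolding list_all2_map1 by (rule list_all2_mono[OF cs]) (rule g_univ)
    from fint[OF f this] show "fint N f cs \<in> univ N (fcod L f)"
      by (auto simp: N_def)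
  qed
  have eval: "eval_trm M (g \<circ> w) t \<in> H \<inter> univ M (sort_of L t) \<and>
      eval_trm N w t = e (eval_trm M (g \<circ> w) t)" if w: "valuation N w" and "wf_trm L t" for w t
    using \<open>wf_trm L t\<close>
  proof (induction t)
    case (Var z)
    have "w z \<in> univ N (snd z)" using w by (rule valuationD)
    then show ?case using g_univ[of "w z"] by (auto simp: N_def ge)
  next
    case (Fn f ts)
    have IH: "eval_trm M (g \<circ> w) t \<in> H \<inter> univ M (sort_of L t)"
        "eval_trm N w t = e (eval_trm M (g \<circ> w) t)" if "t \<in> set ts" for t
      using Fn.IH[OF that] Fn.prems that by (simp_all only: wf_trm.simps)
    have "list_all2 (\<lambda>a s. a \<in> H \<inter> univ M s) (map (eval_trm M (g \<circ> w)) ts) (map (sort_of L) ts)"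
      unfolding list_all2_map1 list_all2_map2 list_all2_same using IH(1) by blast
    then have "fint M f (map (eval_trm M (g \<circ> w)) ts) \<in> H \<inter> univ M (fcod L f)"
      using Fn.prems by (intro fint) (simp_all only: wf_trm.simps)
    moreover have "map g (map (eval_trm N w) ts) = map (eval_trm M (g \<circ> w)) ts"
      unfolding map_map using IH ge by (intro map_cong refl) (metis IntD1 comp_apply)
    ultimately show ?case
      by (simp only: eval_trm.simps sort_of.simps interp_N)
  qed
  have sat: "sat N w \<phi> \<longleftrightarrow> sat M (g \<circ> w) \<phi>" if "valuation N w" "wf_fm L \<phi>" for w \<phi>
    using that
  proof (induction \<phi> arbitrary: w)
    case (Eql t u)
    then show ?case using eval[of w t] eval[of w u] ge by (metis IntD1 sat.simps(1) wf_fm.simps(1))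
  next
    case (Rel r ts)
    then have "map g (map (eval_trm N w) ts) = map (eval_trm M (g \<circ> w)) ts"
      unfolding map_map using eval[of w] ge
      by (intro map_cong refl) (metis IntD1 comp_apply wf_fm.simps(2))
    then show ?case by (simp only: sat.simps interp_N)
  next
    case (Ex z \<phi>)
    have upd: "g \<circ> w(z := c) = (g \<circ> w)(z := g c)" for c by auto
    have IH: "sat N (w(z := c)) \<phi> \<longleftrightarrow> sat M ((g \<circ> w)(z := g c)) \<phi>" if "c \<in> univ N (snd z)" for c
    proof -
      have "valuation N (w(z := c))"
        unfolding valuation_def fun_upd_apply using valuationD[OF Ex.prems(1)] that by metis
      from Ex.IH[OF this] Ex.prems(2) show ?thesis by (simp only: upd wf_fm.simps)
    qed
    have gw: "(g \<circ> w) y \<in> skolem_hull M v" for y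
      using g_univ[OF valuationD[OF Ex.prems(1)]] by (simp add: H_def)
    show ?case
    proof
      assume "sat N w (Ex z \<phi>)"
      then obtain c where "c \<in> univ N (snd z)" "sat N (w(z := c)) \<phi>" by auto
      then show "sat M (g \<circ> w) (Ex z \<phi>)"
        using IH g_univ unfolding sat.simps by blast
    next
      assume "sat M (g \<circ> w) (Ex z \<phi>)"
      then obtain a where "a \<in> univ M (snd z)" "sat M ((g \<circ> w)(z := a)) \<phi>" by auto
      \<comment> \<open>A witness in \<open>M\<close> may have no code; the Tarski-Vaught criterion
        exchanges it for one in the hull.\<close>
      from witness_in_skolem_hull[OF gw this]
      obtain b where b: "b \<in> H \<inter> univ M (snd z)" "sat M ((g \<circ> w)(z := b)) \<phi>"
        unfolding H_def by blast
      then have "sat N (w(z := e b)) \<phi>" using IH[OF e_univ] ge by simp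
      then show "sat N w (Ex z \<phi>)" using e_univ[OF b(1)] by auto
    qed
  qed auto
  show thesis
  proof (rule that[OF struct val])
    show "\<forall>\<phi>. wf_fm L \<phi> \<longrightarrow> (sat N (e \<circ> v) \<phi> \<longleftrightarrow> sat M v \<phi>)"
      using sat[OF val] gv by simp
    show "\<forall>\<phi>. wf_fm L \<phi> \<longrightarrow> valid_in M \<phi> \<longrightarrow> valid_in N \<phi>"
      using sat gval by (auto simp: valid_in_def)
  qed
qed

section \<open>From equivalence modulo the theory to equality of defined relations\<close>

text \<open>Each valuation of \<open>M\<close> is moved to a model of \<open>T\<close> on the type
  of formulas, where entailment applies, and the truth value is read back.\<close>

lemma entails_imp_valid_in:
  assumes "entails L T \<phi>" "wf_fm L \<phi>" "\<And>\<sigma>. \<sigma> \<in> T \<Longrightarrow> sentence L \<sigma>" "is_model L M T"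
  shows "valid_in M \<phi>"
  unfolding valid_in_def
proof (intro allI impI)
  fix v assume v: "valuation M v"
  have M: "is_structure L M" using assms(4) by (simp add: is_model_def)
  obtain N :: "('a, 'b, 'c, ('a, 'b, 'c) fm) interp" and v' where N: "is_structure L N" "valuation N v'"
    "\<forall>\<phi>. wf_fm L \<phi> \<longrightarrow> (sat N v' \<phi> \<longleftrightarrow> sat M v \<phi>)"
    "\<forall>\<phi>. wf_fm L \<phi> \<longrightarrow> valid_in M \<phi> \<longrightarrow> valid_in N \<phi>"
    by (rule downward_Loewenheim_Skolem[OF M v])
  have "is_model L N T"
    using N(1,4) assms(3,4) by (auto simp: is_model_def sentence_def)
  then show "sat M v \<phi>"
    using assms(1,2) N(2,3) by (auto simp: entails_def valid_in_def)
qed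

lemma sat_Iff: "sat M v (Iff \<phi> \<psi>) \<longleftrightarrow> (sat M v \<phi> \<longleftrightarrow> sat M v \<psi>)"
  by (auto simp: Iff_def)

lemma wf_fm_Iff: "wf_fm L (Iff \<phi> \<psi>) \<longleftrightarrow> wf_fm L \<phi> \<and> wf_fm L \<psi>"
  by (auto simp: Iff_def)

text \<open>\<open>holds_at\<close> leaves the variables outside \<open>x\<close> and
  \<open>y\<close> unspecified, whereas validity concerns sort-respecting valuations. The gaps are
  filled with elements of the nonempty universes.\<close>

lemma valuation_extending_tuples:
  assumes "is_structure L M" "a \<in> tuples M x" "b \<in> tuples M y"
  obtains v where "valuation M v"
    "\<forall>z\<in>set x \<union> set y. v z = the (map_of (zip (x @ y) (a @ b)) z)"
proof -
  let ?m = "map_of (zip (x @ y) (a @ b))"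
  define v where "v z = (case ?m z of Some c \<Rightarrow> c | None \<Rightarrow> SOME c. c \<in> univ M (snd z))" for z
  have all: "list_all2 (\<lambda>c z. c \<in> univ M (snd z)) (a @ b) (x @ y)"
    using assms(2,3) by (auto simp: tuples_def list_all2_appendI)
  then have len: "length (x @ y) = length (a @ b)"
    by (simp only: list_all2_lengthD)
  have "c \<in> univ M (snd z)" if "?m z = Some c" for z c
    using map_of_SomeD[OF that] all by (auto simp: list_all2_conv_all_nth set_zip)
  moreover have "(SOME c. c \<in> univ M s) \<in> univ M s" for s
    using assms(1) by (simp add: is_structure_def some_in_eq)
  ultimately have "valuation M v"
    by (auto simp: valuation_def v_def split: option.split)
  moreover have "\<forall>z\<in>set x \<union> set y. v z = the (?m z)"
  proof
    fix z assume "z \<in> set x \<union> set y"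
    then have "z \<in> set (x @ y)" by simp
    then have "?m z \<noteq> None" using map_of_zip_is_None[OF len] by blast
    then show "v z = the (?m z)" by (auto simp: v_def)
  qed
  ultimately show thesis by (rule that)
qed

lemma defined_relation_eqI:
  assumes M: "is_structure L M" and valid: "valid_in M (Iff \<phi> \<psi>)"
    and fv: "fv \<phi> \<subseteq> set x \<union> set y" "fv \<psi> \<subseteq> set x \<union> set y"
  shows "defined_relation M x y \<phi> = defined_relation M x y \<psi>"
proof -
  have "holds_at M x y \<phi> a b \<longleftrightarrow> holds_at M x y \<psi> a b"
    if ab: "a \<in> tuples M x" "b \<in> tuples M y" for a b
  proof -
    obtain v where v: "valuation M v"
      "\<forall>z\<in>set x \<union> set y. v z = the (map_of (zip (x @ y) (a @ b)) z)"
      by (rule valuation_extending_tuples[OF M ab])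
    have "holds_at M x y \<theta> a b \<longleftrightarrow> sat M v \<theta>" if "fv \<theta> \<subseteq> set x \<union> set y" for \<theta>
      unfolding holds_at_def using v(2) that by (intro sat_cong) (metis subsetD)
    then show ?thesis
      using v(1) valid fv by (auto simp: valid_in_def sat_Iff)
  qed
  then show ?thesis by (auto simp: defined_relation_def)
qed

lemma defined_relation_Neg:
  "defined_relation M x y (Neg \<phi>) = tuples M x \<times> tuples M y - defined_relation M x y \<phi>"
  by (auto simp: defined_relation_def holds_at_def)

lemma defined_relation_Conj:
  "defined_relation M x y (Conj \<phi> \<psi>) = defined_relation M x y \<phi> \<inter> defined_relation M x y \<psi>"
  by (auto simp: defined_relation_def holds_at_def)

section \<open>Semi-equations\<close>

text \<open>An antichain of \<open>k\<close> fibres through \<open>a\<close> would give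
  \<open>k\<close> parameters whose instances meet in \<open>a\<close> without any inclusion between
  two of them.\<close>

lemma sEH_one_semi_equation:
  assumes "one_semi_equation L M x y \<phi>"
  shows "sEH (tuples M x) (tuples M y) (defined_relation M x y \<phi>)"
proof -
  obtain k where semi: "\<And>b :: nat \<Rightarrow> 'd list. (\<forall>i\<in>{1..k}. b i \<in> tuples M y) \<Longrightarrow>
      (\<Inter>i\<in>{1..k}. instance_set M x y \<phi> (b i)) \<noteq> {} \<Longrightarrow>
      \<exists>i\<in>{1..k}. \<exists>j\<in>{1..k}. i \<noteq> j \<and> instance_set M x y \<phi> (b i) \<subseteq> instance_set M x y \<phi> (b j)"
    using assms unfolding one_semi_equation_def k1_semi_equation_def by blast
  have fibre: "{a \<in> tuples M x. (a, b) \<in> defined_relation M x y \<phi>} = instance_set M x y \<phi> b"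
    if "b \<in> tuples M y" for b
    using that by (auto simp: defined_relation_def instance_set_def)
  show ?thesis
  proof (rule sEH_of_bounded_antichains[where k = k])
    fix a \<A>
    assume \<A>: "\<A> \<subseteq> (\<lambda>b. {a \<in> tuples M x. (a, b) \<in> defined_relation M x y \<phi>}) ` tuples M y"
      "finite \<A>" "antichain \<A>" "a \<in> \<Inter>\<A>"
    show "card \<A> < k"
    proof (rule ccontr)
      assume "\<not> card \<A> < k"
      \<comment> \<open>For \<open>k = 0\<close> the family is empty and \<open>semi\<close> yields
        an index from an empty range, so the contradiction arises in this case too.\<close>
      then obtain S where S: "S \<subseteq> \<A>" "card S = k" "finite S"
        using obtain_subset_with_card_n[of k \<A>] by (metis not_less)
      then obtain h where h: "bij_betw h {1..k} S"
        using ex_bij_betw_nat_finite_1 by blast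
      have in_\<A>: "h i \<in> \<A>" if "i \<in> {1..k}" for i
        using that bij_betwE[OF h] S(1) by blast
      have "\<forall>i\<in>{1..k}. \<exists>b\<in>tuples M y. instance_set M x y \<phi> b = h i"
      proof
        fix i assume i: "i \<in> {1..k}"
        obtain b where b: "b \<in> tuples M y"
          "h i = {a \<in> tuples M x. (a, b) \<in> defined_relation M x y \<phi>}"
          using subsetD[OF \<A>(1) in_\<A>[OF i]] by (elim imageE)
        have "instance_set M x y \<phi> b = h i" using fibre[OF b(1)] b(2) by (simp only:)
        with b(1) show "\<exists>b\<in>tuples M y. instance_set M x y \<phi> b = h i" by (rule bexI[rotated])
      qed
      then obtain b where b: "\<forall>i\<in>{1..k}. b i \<in> tuples M y \<and> instance_set M x y \<phi> (b i) = h i"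
        by metis
      have "a \<in> (\<Inter>i\<in>{1..k}. instance_set M x y \<phi> (b i))"
        using b in_\<A> \<A>(4) by auto
      then have "\<exists>i\<in>{1..k}. \<exists>j\<in>{1..k}. i \<noteq> j \<and>
          instance_set M x y \<phi> (b i) \<subseteq> instance_set M x y \<phi> (b j)"
        using b by (intro semi) blast+
      then obtain i j where ij: "i \<in> {1..k}" "j \<in> {1..k}" "i \<noteq> j"
        and sub: "instance_set M x y \<phi> (b i) \<subseteq> instance_set M x y \<phi> (b j)"
        by blast
      have "h i \<subseteq> h j" using sub b ij(1,2) by metis
      then have "h i = h j"
        using in_\<A>[OF ij(1)] in_\<A>[OF ij(2)] \<A>(3) unfolding antichain_def by blast
      then show False
        using ij bij_betw_imp_inj_on[OF h] by (blast dest: inj_onD)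
    qed
  qed
qed

text \<open>Well-formedness and the bound on free variables are carried through the induction
  because the transfer of an equivalence to \<open>M\<close> asks for them.\<close>

lemma sEH_bool_comb:
  assumes "bool_comb (one_semi_equation L M x y) \<psi>"
  shows "wf_fm L \<psi> \<and> fv \<psi> \<subseteq> set x \<union> set y \<and>
    sEH (tuples M x) (tuples M y) (defined_relation M x y \<psi>)"
  using assms
proof induction
  case (base \<psi>)
  then show ?case
    using sEH_one_semi_equation[OF base]
    by (auto simp: one_semi_equation_def k1_semi_equation_def partitioned_def)
qed (simp_all add: defined_relation_Neg defined_relation_Conj sEH_Compl sEH_Int)

theorem theorem3p3:
  fixes L :: "('f, 'r, 's) language"
    and T :: "('f, 'r, 's) fm set"
    and M :: "('f, 'r, 's, 'a) interp"
  assumes "complete_theory L T"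
    and "is_model L M T"
  shows "(\<forall>x y \<phi>. one_semi_equation L M x y \<phi> \<longrightarrow>
            sEH (tuples M x) (tuples M y) (defined_relation M x y \<phi>)) \<and>
         (one_semi_equational L M T \<longrightarrow>
            (\<forall>x y \<phi>. partitioned L x y \<phi> \<longrightarrow>
               sEH (tuples M x) (tuples M y) (defined_relation M x y \<phi>)))"
proof (intro conjI allI impI)
  fix x y and \<phi> :: "('f, 'r, 's) fm"
  assume "one_semi_equation L M x y \<phi>"
  then show "sEH (tuples M x) (tuples M y) (defined_relation M x y \<phi>)"
    by (rule sEH_one_semi_equation)
next
  fix x y and \<phi> :: "('f, 'r, 's) fm"
  assume "one_semi_equational L M T" and \<phi>: "partitioned L x y \<phi>"
  then obtain \<psi> where comb: "bool_comb (one_semi_equation L M x y) \<psi>"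
    and equiv: "equivalent_in L T \<phi> \<psi>"
    unfolding one_semi_equational_def by blast
  note \<psi> = sEH_bool_comb[OF comb]
  have "valid_in M (Iff \<phi> \<psi>)"
  proof (rule entails_imp_valid_in[OF _ _ _ assms(2)])
    show "entails L T (Iff \<phi> \<psi>)" using equiv by (simp add: equivalent_in_def)
    show "wf_fm L (Iff \<phi> \<psi>)" using \<phi> \<psi> by (simp add: wf_fm_Iff partitioned_def)
    show "sentence L \<sigma>" if "\<sigma> \<in> T" for \<sigma>
      using assms(1) that by (simp add: complete_theory_def)
  qed
  then have "defined_relation M x y \<phi> = defined_relation M x y \<psi>"
    using assms(2) \<phi> \<psi> by (intro defined_relation_eqI[of L]) (auto simp: is_model_def partitioned_def)
  with \<psi> show "sEH (tuples M x) (tuples M y) (defined_relation M x y \<phi>)" by simp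
qed

end
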